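(* Let $R$ be a commutative Noetherian ring, $I$ an ideal of $R$ and $M$ a finitely generated $R$-module. Then $\widetilde{I^nM}=I^nM+H^0_I(M)$ for all $n\gg 0$.
   Context: $H^0_I(M)=\{m\in M : I^nm=0 \text{ for some } n\geq 1\}$. For a submodule $A$ of $M$ and an ideal $L$ of $R$, $(A:_M L)=\{m\in M : Lm\subseteq A\}$. For $n\geq 1$, $\widetilde{I^nM}=\bigcup_{k\geq 1}(I^{n+k}M:_M I^k)$, an ascending union of submodules of $M$ (the Ratliff-Rush submodule of $M$ associated with $I^n$). *)

theory Defs
  imports "HOL-Algebra.Module" "HOL-Algebra.Ideal_Product" "HOL-Algebra.Ring_Divisibility"
begin

definition gen_submodule ::
  "('a, 'c) ring_scheme \<Rightarrow> ('a, 'b, 'd) module_scheme \<Rightarrow> 'b set \<Rightarrow> 'b set"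
  where "gen_submodule R M S = \<Inter>{N. submodule N R M \<and> S \<subseteq> N}"

definition fin_gen_module ::
  "('a, 'c) ring_scheme \<Rightarrow> ('a, 'b, 'd) module_scheme \<Rightarrow> bool"
  where "fin_gen_module R M \<longleftrightarrow>
    (\<exists>A \<subseteq> carrier M. finite A \<and> carrier M = gen_submodule R M A)"

text \<open>Powers are taken in the monoid of ideals of \<open>R\<close> under the ideal product, whose unit
  is \<open>carrier R\<close>; in particular the zeroth power of an ideal is the whole ring.\<close>

definition ideal_pow :: "('a, 'c) ring_scheme \<Rightarrow> 'a set \<Rightarrow> nat \<Rightarrow> 'a set"
  where "ideal_pow R I n = I [^]\<^bsub>ideals_set R\<^esub> n"

definition ideal_smult ::
  "('a, 'c) ring_scheme \<Rightarrow> ('a, 'b, 'd) module_scheme \<Rightarrow> 'a set \<Rightarrow> 'b set"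
  where "ideal_smult R M L =
    gen_submodule R M {a \<odot>\<^bsub>M\<^esub> x | a x. a \<in> L \<and> x \<in> carrier M}"

definition colon_module ::
  "('a, 'b, 'd) module_scheme \<Rightarrow> 'b set \<Rightarrow> 'a set \<Rightarrow> 'b set"
  where "colon_module M A L = {m \<in> carrier M. \<forall>a\<in>L. a \<odot>\<^bsub>M\<^esub> m \<in> A}"

definition H0 ::
  "('a, 'c) ring_scheme \<Rightarrow> ('a, 'b, 'd) module_scheme \<Rightarrow> 'a set \<Rightarrow> 'b set"
  where "H0 R M I =
    {m \<in> carrier M. \<exists>n\<ge>1. \<forall>a\<in>ideal_pow R I n. a \<odot>\<^bsub>M\<^esub> m = \<zero>\<^bsub>M\<^esub>}"

definition ratliff_rush ::
  "('a, 'c) ring_scheme \<Rightarrow> ('a, 'b, 'd) module_scheme \<Rightarrow> 'a set \<Rightarrow> nat \<Rightarrow> 'b set"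
  where "ratliff_rush R M I n =
    (\<Union>k\<in>{1..}. colon_module M (ideal_smult R M (ideal_pow R I (n + k))) (ideal_pow R I k))"

end

theory Submission
  imports Defs "HOL-Library.Multiset_Order" "HOL-Library.Product_Lexorder"
begin

text \<open>Write \<open>H\<close> for \<open>H\<^sup>0\<^sub>I(M)\<close>. That \<open>I\<^sup>nM + H\<close> lies in the Ratliff-Rush submodule holds for every \<open>n\<close>:
a power of \<open>I\<close> that kills a given \<open>h \<in> H\<close> multiplies \<open>I\<^sup>nM\<close> into a higher power
(\<open>IM_H_subset_ratliff_rush\<close>). The reverse inclusion for large \<open>n\<close> comes from the stability
\<open>(I\<^sup>d\<^sup>+\<^sup>1M + H : I) = I\<^sup>dM + H\<close> for all large \<open>d\<close> (\<open>colon_stable\<close>), because an \<open>x\<close> with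
\<open>I\<^sup>k x \<subseteq> I\<^sup>n\<^sup>+\<^sup>kM\<close> then descends one power of \<open>I\<close> at a time to \<open>x \<in> I\<^sup>nM + H\<close>
(\<open>colon_power_stable\<close>).

The stability is a finite generation statement over the Rees algebra of \<open>I\<close>. Let \<open>I\<close> be generated
by \<open>a\<^sub>i\<close> for \<open>i < s\<close>, and put \<open>N\<^sub>d = (I\<^sup>dM + H : I)\<close>. The map \<open>m \<mapsto> (a\<^sub>i m)\<^sub>i\<close> sends \<open>N\<^sub>d\<close> into
the \<open>s\<close>-fold direct sum of \<open>(I\<^sup>dM + H)/H\<close>, and its kernel is \<open>(H : I)\<close>, which is \<open>H\<close>
(\<open>H0_colon\<close>). Summed over \<open>d\<close>, the images form a graded submodule of a finitely generated
graded module over \<open>R[x\<^sub>0, \<dots>, x\<^sub>s\<^sub>-\<^sub>1]\<close>, where \<open>x\<^sub>k\<close> acts as multiplication by \<open>a\<^sub>k\<close> into the next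
degree. By Hilbert's basis theorem it is generated in bounded degree, so
\<open>N\<^sub>d\<^sub>+\<^sub>1 = I N\<^sub>d + H\<close> for large \<open>d\<close>; and \<open>I N\<^sub>d \<subseteq> I\<^sup>dM + H\<close> by the definition of \<open>N\<^sub>d\<close>.

The graded basis theorem is \<open>graded_submodule_generated\<close>. Its proof attaches to each monomial the
ideal of leading coefficients of the forms in the submodule that have this leading monomial. These
ideals grow along divisibility of monomials, and Dickson's lemma with the ascending chain condition
shows that from some degree on each of them equals the one at a proper divisor
(\<open>multiset_indexed_ideals_stabilize\<close>). Leading terms can then be cancelled by multiples of forms
one degree lower. To apply it, elements of \<open>I\<^sup>dM\<close> are written as values of forms of degree \<open>d\<close> at
the generators (\<open>evaluate_surj\<close>), and the pulled-back graded submodule consists of the forms that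
represent some \<open>m\<close> in the sense of \<open>represents\<close>.\<close>

section \<open>Dickson's lemma and stabilization of ideals\<close>

lemma nat_sequence_monotone_subsequence:
  fixes c :: "nat \<Rightarrow> nat"
  obtains h :: "nat \<Rightarrow> nat" where "strict_mono h" "mono (\<lambda>p. c (h p))"
proof -
  obtain h where h: "strict_mono h" "monoseq (\<lambda>p. c (h p))"
    using seq_monosub by blast
  show thesis
  proof (cases "mono (\<lambda>p. c (h p))")
    case True
    show ?thesis by (rule that[OF h(1) True])
  next
    case False
    then have dec: "\<And>p q. p \<le> q \<Longrightarrow> c (h q) \<le> c (h p)"
      using h(2) by (auto simp: monoseq_def mono_def)
    obtain P where P: "\<And>q. c (h P) \<le> c (h q)"
      using ex_has_least_nat[of "\<lambda>_. True" 0 "\<lambda>p. c (h p)"] by auto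
    have "c (h (P + p)) = c (h P)" for p
      by (rule antisym[OF dec P]) simp
    moreover have "strict_mono (\<lambda>p. h (P + p))"
      using h(1) by (simp add: strict_mono_def)
    ultimately show ?thesis using that[of "\<lambda>p. h (P + p)"] by (simp add: mono_def)
  qed
qed

text \<open>Dickson's lemma in sequence form, for monomials encoded as multisets of variables, so that divisibility is \<open>\<subseteq>#\<close>. A monotone subsequence is extracted for one variable after the other; passing to a further subsequence keeps the monotonicity already obtained.\<close>

lemma dickson_subsequence:
  fixes b :: "nat \<Rightarrow> 'v multiset"
  assumes "finite A" and "\<And>p. set_mset (b p) \<subseteq> A"
  obtains g :: "nat \<Rightarrow> nat" where "strict_mono g" "\<And>p q. p \<le> q \<Longrightarrow> b (g p) \<subseteq># b (g q)"
proof -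
  have "\<exists>g :: nat \<Rightarrow> nat. strict_mono g \<and> (\<forall>v\<in>A. mono (\<lambda>p. count (b (g p)) v))"
    using \<open>finite A\<close>
  proof induction
    case empty
    show ?case by (auto intro: exI[of _ id] simp: strict_mono_def)
  next
    case (insert v A)
    then obtain g :: "nat \<Rightarrow> nat" where g: "strict_mono g" "\<forall>v\<in>A. mono (\<lambda>p. count (b (g p)) v)"
      by blast
    obtain h :: "nat \<Rightarrow> nat" where h: "strict_mono h" "mono (\<lambda>p. count (b (g (h p))) v)"
      by (rule nat_sequence_monotone_subsequence[of "\<lambda>p. count (b (g p)) v"])
    have "strict_mono (\<lambda>p. g (h p))"
      using g(1) h(1) by (simp add: strict_mono_def)
    moreover have "mono (\<lambda>p. count (b (g (h p))) w)" if "w \<in> A" for w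
      using g(2) that h(1) by (auto simp: mono_def strict_mono_less_eq)
    ultimately show ?case using h(2)
      by (intro exI[of _ "\<lambda>p. g (h p)"]) auto
  qed
  then obtain g :: "nat \<Rightarrow> nat" where g: "strict_mono g" "\<forall>v\<in>A. mono (\<lambda>p. count (b (g p)) v)"
    by blast
  have "b (g p) \<subseteq># b (g q)" if "p \<le> q" for p q
  proof (rule mset_subset_eqI)
    fix v
    show "count (b (g p)) v \<le> count (b (g q)) v"
    proof (cases "v \<in> A")
      case True
      then show ?thesis using g(2) that by (auto simp: mono_def)
    next
      case False
      then have "v \<notin># b (g p)" using assms(2) by blast
      then show ?thesis by (simp add: not_in_iff)
    qed
  qed
  with g(1) that show thesis by blast
qed

locale noetherian_cring = noetherian_ring + cring

lemma (in noetherian_ring) ascending_ideals_stabilize: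
  fixes J :: "nat \<Rightarrow> 'a set"
  assumes "\<And>p. ideal (J p) R" and "\<And>p q. p \<le> q \<Longrightarrow> J p \<subseteq> J q"
  obtains P where "\<And>q. P \<le> q \<Longrightarrow> J q = J P"
proof -
  have "subset.chain {I. ideal I R} (range J)"
    unfolding subset_chain_def using assms(1) assms(2) by (auto, meson nat_le_linear subsetD)
  then have "\<Union> (range J) \<in> range J"
    by (intro ideal_chain_is_trivial) auto
  then obtain P where P: "\<Union> (range J) = J P" by blast
  show thesis
  proof
    fix q assume "P \<le> q"
    then show "J q = J P" using assms(2)[of P q] P by blast
  qed
qed

text \<open>Otherwise there are monomials of unbounded degree at which \<open>L\<close> is strictly larger than at every
maximal proper divisor. By Dickson's lemma infinitely many of them form a divisibility chain, along
which \<open>L\<close> stabilizes by the chain condition; but between two members of different degree lies a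
maximal proper divisor of the larger one, and \<open>L\<close> is squeezed there.\<close>

lemma (in noetherian_ring) multiset_indexed_ideals_stabilize:
  fixes L :: "'v multiset \<Rightarrow> 'a set"
  assumes fin: "finite A"
    and ide: "\<And>\<beta>. set_mset \<beta> \<subseteq> A \<Longrightarrow> ideal (L \<beta>) R"
    and step: "\<And>\<beta> k. set_mset \<beta> \<subseteq> A \<Longrightarrow> k \<in> A \<Longrightarrow> L \<beta> \<subseteq> L (add_mset k \<beta>)"
  shows "\<forall>\<^sub>F d in sequentially. \<forall>\<beta>\<in>multisets_of_size A d. \<exists>k\<in>#\<beta>. L (\<beta> - {#k#}) = L \<beta>"
proof (rule ccontr)
  assume "\<not> ?thesis"
  then have "\<forall>p. \<exists>\<beta>. p \<le> size \<beta> \<and> set_mset \<beta> \<subseteq> A \<and> (\<forall>k\<in>#\<beta>. L (\<beta> - {#k#}) \<noteq> L \<beta>)"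
    unfolding eventually_sequentially multisets_of_size_def by auto
  then obtain b where b: "\<And>p. p \<le> size (b p)" "\<And>p. set_mset (b p) \<subseteq> A"
    and bad: "\<And>p k. k \<in># b p \<Longrightarrow> L (b p - {#k#}) \<noteq> L (b p)"
    by metis
  have mono_add: "L \<beta> \<subseteq> L (\<beta> + \<gamma>)" if "set_mset (\<beta> + \<gamma>) \<subseteq> A" for \<beta> \<gamma>
    using that
  proof (induction \<gamma>)
    case (add k \<gamma>)
    then have "L \<beta> \<subseteq> L (\<beta> + \<gamma>)" by simp
    also have "\<dots> \<subseteq> L (add_mset k (\<beta> + \<gamma>))" by (rule step) (use add.prems in simp_all)
    finally show ?case by simp
  qed simp
  have mono: "L \<beta> \<subseteq> L \<gamma>" if "\<beta> \<subseteq># \<gamma>" "set_mset \<gamma> \<subseteq> A" for \<beta> \<gamma>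
    using mono_add[of \<beta> "\<gamma> - \<beta>"] that by simp
  obtain g :: "nat \<Rightarrow> nat" where g: "strict_mono g" "\<And>p q. p \<le> q \<Longrightarrow> b (g p) \<subseteq># b (g q)"
    using dickson_subsequence[of A b, OF fin b(2)] by blast
  obtain P where P: "\<And>q. P \<le> q \<Longrightarrow> L (b (g q)) = L (b (g P))"
    by (rule ascending_ideals_stabilize[of "\<lambda>p. L (b (g p))"]) (use ide mono b(2) g(2) in auto)
  \<comment> \<open>large enough for \<open>b (g q)\<close> to have larger degree than \<open>b (g P)\<close>, so that the two differ\<close>
  define q where "q = max P (Suc (size (b (g P))))"
  have "size (b (g P)) < q" by (simp add: q_def)
  also have "q \<le> g q" using g(1) by (rule strict_mono_imp_increasing)
  also have "g q \<le> size (b (g q))" by (rule b(1))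
  finally have "b (g P) \<noteq> b (g q)" by auto
  moreover have sub: "b (g P) \<subseteq># b (g q)" by (rule g(2)) (simp add: q_def)
  ultimately have "b (g q) - b (g P) \<noteq> {#}"
    using subset_mset.add_diff_inverse by fastforce
  then obtain k where k: "k \<in># b (g q) - b (g P)" by blast
  then have kq: "k \<in># b (g q)" by (rule in_diffD)
  have "add_mset k (b (g P)) \<subseteq># (b (g q) - b (g P)) + b (g P)"
    using k by (metis mset_add mset_subset_eq_add_right mset_subset_eq_add_mset_cancel union_mset_add_mset_left)
  then have "b (g P) \<subseteq># b (g q) - {#k#}"
    using sub by (simp add: insert_subset_eq_iff)
  then have "L (b (g P)) \<subseteq> L (b (g q) - {#k#})"
    by (rule mono) (use b(2)[of "g q"] in \<open>auto dest: in_diffD\<close>)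
  moreover have "L (b (g q) - {#k#}) \<subseteq> L (b (g q))"
    by (rule mono) (use b(2)[of "g q"] in simp_all)
  moreover have "L (b (g q)) = L (b (g P))" by (rule P) (simp add: q_def)
  ultimately show False using bad[OF kq] by blast
qed

section \<open>Graded submodules of a free module over a polynomial ring\<close>

text \<open>A function on pairs \<open>(\<tau>, \<beta>)\<close> holds the coefficients of an element of the free module with basis
indexed by \<open>\<tau>\<close> over the polynomial ring in the variables \<open>'v\<close>, and \<open>\<beta>\<close> is the monomial in which
each variable occurs as often as in the multiset. On coefficient functions, \<open>shift R k\<close> is
multiplication by the variable \<open>k\<close>.\<close>

definition shift :: "('a, 'c) ring_scheme \<Rightarrow> 'v \<Rightarrow> ('t \<times> 'v multiset \<Rightarrow> 'a) \<Rightarrow> 't \<times> 'v multiset \<Rightarrow> 'a"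
  where "shift R k f = (\<lambda>(\<tau>, \<beta>). if k \<in># \<beta> then f (\<tau>, \<beta> - {#k#}) else \<zero>\<^bsub>R\<^esub>)"

lemma shift_add_mset [simp]: "shift R k f (\<tau>, add_mset k \<beta>) = f (\<tau>, \<beta>)"
  by (simp add: shift_def)

definition homogeneous ::
  "('a, 'c) ring_scheme \<Rightarrow> 't set \<Rightarrow> 'v set \<Rightarrow> nat \<Rightarrow> ('t \<times> 'v multiset \<Rightarrow> 'a) set"
  where "homogeneous R T A d =
    {f. (\<forall>x. f x \<in> carrier R) \<and> (\<forall>x. x \<notin> T \<times> multisets_of_size A d \<longrightarrow> f x = \<zero>\<^bsub>R\<^esub>)}"

text \<open>The graded form of Hilbert's basis theorem: in large degrees, the part of degree \<open>d + 1\<close> is spanned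
by the products of variables with forms of degree \<open>d\<close>. Spanning is expressed by an arbitrary
additively closed set \<open>D\<close> that contains these products, so that a property of such products transfers to all forms of degree \<open>d + 1\<close>.

Pairs \<open>(\<tau>, \<beta>)\<close> are ordered lexicographically, with the multiset order on monomials. Multiplication
by a variable is strictly monotone for this order, hence maps leading terms to leading terms.\<close>

lemma (in noetherian_cring) graded_submodule_generated:
  fixes N :: "nat \<Rightarrow> ('t::linorder \<times> 'v::linorder multiset \<Rightarrow> 'a) set"
  assumes T: "finite T" and A: "finite A"
    and hom: "\<And>d. N d \<subseteq> homogeneous R T A d"
    and zero: "\<And>d. (\<lambda>x. \<zero>) \<in> N d"
    and add: "\<And>d f g. f \<in> N d \<Longrightarrow> g \<in> N d \<Longrightarrow> (\<lambda>x. f x \<oplus> g x) \<in> N d"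
    and smult: "\<And>d f r. f \<in> N d \<Longrightarrow> r \<in> carrier R \<Longrightarrow> (\<lambda>x. r \<otimes> f x) \<in> N d"
    and shift: "\<And>d f k. f \<in> N d \<Longrightarrow> k \<in> A \<Longrightarrow> shift R k f \<in> N (Suc d)"
  shows "\<forall>\<^sub>F d in sequentially. \<forall>D. (\<lambda>x. \<zero>) \<in> D
    \<longrightarrow> (\<forall>f\<in>D. \<forall>g\<in>D. (\<lambda>x. f x \<oplus> g x) \<in> D)
    \<longrightarrow> (\<forall>k\<in>A. \<forall>f\<in>N d. shift R k f \<in> D) \<longrightarrow> N (Suc d) \<subseteq> D"
proof -
  \<comment> \<open>\<open>L \<tau> \<beta>\<close> is the ideal of coefficients at \<open>(\<tau>, \<beta>)\<close> of forms with no term above it\<close>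
  define vanishes_above where "vanishes_above f x \<longleftrightarrow> (\<forall>y>x. f y = \<zero>)"
    for f :: "'t \<times> 'v multiset \<Rightarrow> 'a" and x
  define L where "L \<tau> \<beta> = {f (\<tau>, \<beta>) | f. f \<in> N (size \<beta>) \<and> vanishes_above f (\<tau>, \<beta>)}" for \<tau> \<beta>
  have L_I: "f (\<tau>, \<beta>) \<in> L \<tau> \<beta>" if "f \<in> N (size \<beta>)" "vanishes_above f (\<tau>, \<beta>)" for f \<tau> \<beta>
    using that unfolding L_def by blast
  have L_E: "\<exists>f. c = f (\<tau>, \<beta>) \<and> f \<in> N (size \<beta>) \<and> vanishes_above f (\<tau>, \<beta>)" if "c \<in> L \<tau> \<beta>" for c \<tau> \<beta>
    using that unfolding L_def by blast
  have car: "f x \<in> carrier R" if "f \<in> N d" for f x d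
    using hom[of d] that unfolding homogeneous_def by blast
  have ideal_L: "ideal (L \<tau> \<beta>) R" for \<tau> \<beta>
  proof (rule idealI)
    show "ring R" by (rule ring_axioms)
    have mul: "r \<otimes> c \<in> L \<tau> \<beta>" if c: "c \<in> L \<tau> \<beta>" and r: "r \<in> carrier R" for r c
    proof -
      obtain f where f: "c = f (\<tau>, \<beta>)" "f \<in> N (size \<beta>)" "vanishes_above f (\<tau>, \<beta>)"
        using L_E[OF c] by blast
      have "vanishes_above (\<lambda>y. r \<otimes> f y) (\<tau>, \<beta>)"
        using f(3) r by (simp add: vanishes_above_def del: split_paired_All)
      from L_I[OF smult[OF f(2) r] this] show ?thesis by (simp add: f(1))
    qed
    have cl: "L \<tau> \<beta> \<subseteq> carrier R" using car unfolding L_def by blast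
    show "subgroup (L \<tau> \<beta>) (add_monoid R)"
    proof (rule add.subgroupI)
      show "L \<tau> \<beta> \<subseteq> carrier R" by (rule cl)
      have "vanishes_above (\<lambda>x. \<zero>) (\<tau>, \<beta>)" by (simp add: vanishes_above_def)
      from L_I[OF zero this] show "L \<tau> \<beta> \<noteq> {}" by blast
      show "\<ominus> c \<in> L \<tau> \<beta>" if "c \<in> L \<tau> \<beta>" for c
        using mul[OF that, of "\<ominus> \<one>"] subsetD[OF cl that] by (simp add: l_minus)
      show "c \<oplus> c' \<in> L \<tau> \<beta>" if c: "c \<in> L \<tau> \<beta>" and c': "c' \<in> L \<tau> \<beta>" for c c'
      proof -
        obtain f where f: "c = f (\<tau>, \<beta>)" "f \<in> N (size \<beta>)" "vanishes_above f (\<tau>, \<beta>)"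
          using L_E[OF c] by blast
        obtain f' where f': "c' = f' (\<tau>, \<beta>)" "f' \<in> N (size \<beta>)" "vanishes_above f' (\<tau>, \<beta>)"
          using L_E[OF c'] by blast
        have "vanishes_above (\<lambda>y. f y \<oplus> f' y) (\<tau>, \<beta>)"
          using f(3) f'(3) by (simp add: vanishes_above_def del: split_paired_All)
        from L_I[OF add[OF f(2) f'(2)] this] show ?thesis by (simp add: f(1) f'(1))
      qed
    qed
    fix c r assume c: "c \<in> L \<tau> \<beta>" and r: "r \<in> carrier R"
    show "r \<otimes> c \<in> L \<tau> \<beta>" by (rule mul[OF c r])
    then show "c \<otimes> r \<in> L \<tau> \<beta>" using m_comm[OF subsetD[OF cl c] r] by simp
  qed
  have shift_lead: "vanishes_above (shift R k f) (\<tau>, add_mset k \<beta>)"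
    if f: "vanishes_above f (\<tau>, \<beta>)" for k f \<tau> \<beta>
    unfolding vanishes_above_def
  proof (intro allI impI)
    fix y assume y: "y > (\<tau>, add_mset k \<beta>)"
    obtain \<tau>' \<gamma> where Pair: "y = (\<tau>', \<gamma>)" by fastforce
    show "shift R k f y = \<zero>"
    proof (cases "k \<in># \<gamma>")
      case True
      then obtain \<delta> where \<delta>: "\<gamma> = add_mset k \<delta>" by (metis mset_add)
      have "(\<tau>, \<beta>) < (\<tau>', \<delta>)"
        using y add_less_cancel_left[of "{#k#}" \<beta> \<delta>] by (auto simp: Pair \<delta>)
      then show ?thesis using f unfolding vanishes_above_def Pair \<delta> shift_add_mset by blast
    qed (simp add: Pair shift_def)
  qed
  have "L \<tau> \<beta> \<subseteq> L \<tau> (add_mset k \<beta>)" if k: "k \<in> A" for \<tau> \<beta> k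
  proof
    fix c assume "c \<in> L \<tau> \<beta>"
    then obtain f where f: "c = f (\<tau>, \<beta>)" "f \<in> N (size \<beta>)" "vanishes_above f (\<tau>, \<beta>)"
      using L_E by blast
    from L_I[OF _ shift_lead[OF f(3)], of k] shift[OF f(2) k]
    show "c \<in> L \<tau> (add_mset k \<beta>)" by (simp add: f(1))
  qed
  then have "\<forall>\<^sub>F d in sequentially. \<forall>\<beta>\<in>multisets_of_size A d.
      \<exists>k\<in>#\<beta>. L \<tau> (\<beta> - {#k#}) = L \<tau> \<beta>" for \<tau>
    by (intro multiset_indexed_ideals_stabilize A ideal_L)
  then have "\<forall>\<^sub>F d in sequentially. \<forall>\<tau>\<in>T. \<forall>\<beta>\<in>multisets_of_size A d.
      \<exists>k\<in>#\<beta>. L \<tau> (\<beta> - {#k#}) = L \<tau> \<beta>"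
    by (intro eventually_ball_finite T) blast
  then have "\<forall>\<^sub>F d in sequentially. \<forall>\<tau>\<in>T. \<forall>\<beta>\<in>multisets_of_size A (Suc d).
      \<exists>k\<in>#\<beta>. L \<tau> (\<beta> - {#k#}) = L \<tau> \<beta>"
    by (rule eventually_sequentially_Suc[THEN iffD2])
  then show ?thesis
  proof (rule eventually_mono, intro allI impI subsetI)
    fix d D f
    assume stable: "\<forall>\<tau>\<in>T. \<forall>\<beta>\<in>multisets_of_size A (Suc d). \<exists>k\<in>#\<beta>. L \<tau> (\<beta> - {#k#}) = L \<tau> \<beta>"
      and D0: "(\<lambda>x. \<zero>) \<in> D"
      and Dadd: "\<forall>f\<in>D. \<forall>g\<in>D. (\<lambda>x. f x \<oplus> g x) \<in> D"
      and Dshift: "\<forall>k\<in>A. \<forall>f\<in>N d. shift R k f \<in> D"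
      and "f \<in> N (Suc d)"
    define X where "X = T \<times> multisets_of_size A (Suc d)"
    have finX: "finite X" unfolding X_def
      by (intro finite_cartesian_product T finite_multisets_of_size A)
    \<comment> \<open>the terms up to the leading one: their number decreases when the leading term is cancelled\<close>
    define below where "below f = {x\<in>X. \<exists>y\<ge>x. f y \<noteq> \<zero>}" for f :: "'t \<times> 'v multiset \<Rightarrow> 'a"
    have outside: "f y = \<zero>" if "f \<in> N (Suc d)" "y \<notin> X" for f y
      using hom[of "Suc d"] that unfolding homogeneous_def X_def by blast
    show "f \<in> D"
      using \<open>f \<in> N (Suc d)\<close>
    proof (induction "card (below f)" arbitrary: f rule: less_induct)
      case less
      note f = \<open>f \<in> N (Suc d)\<close>
      show ?case
      proof (cases "\<forall>x. f x = \<zero>")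
        case True
        then have "f = (\<lambda>x. \<zero>)" by auto
        then show ?thesis using D0 by simp
      next
        case False
        define S where "S = {x. f x \<noteq> \<zero>}"
        have S: "finite S" "S \<noteq> {}" "S \<subseteq> X"
        proof -
          show "S \<subseteq> X" using outside[OF f] unfolding S_def by blast
          then show "finite S" using finX by (rule finite_subset)
          show "S \<noteq> {}" using False unfolding S_def by blast
        qed
        obtain \<tau> \<beta> where lead: "Max S = (\<tau>, \<beta>)" by fastforce
        have in_S: "(\<tau>, \<beta>) \<in> S" using Max_in[OF S(1,2)] lead by simp
        have above: "vanishes_above f (\<tau>, \<beta>)"
          unfolding vanishes_above_def
        proof (intro allI impI)
          fix y assume "y > (\<tau>, \<beta>)"
          then have "y \<notin> S" using Max_ge[OF S(1), of y] unfolding lead by (meson leD)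
          then show "f y = \<zero>" by (simp add: S_def)
        qed
        have \<tau>: "\<tau> \<in> T" and \<beta>: "\<beta> \<in> multisets_of_size A (Suc d)"
          using in_S S(3) by (auto simp: X_def)
        have size: "size \<beta> = Suc d" and sub: "set_mset \<beta> \<subseteq> A"
          using \<beta> by (auto simp: multisets_of_size_def)
        obtain k where k: "k \<in># \<beta>" "L \<tau> (\<beta> - {#k#}) = L \<tau> \<beta>"
          using stable \<tau> \<beta> by blast
        have "f (\<tau>, \<beta>) \<in> L \<tau> \<beta>" by (rule L_I) (use f above size in simp_all)
        then obtain g where g: "f (\<tau>, \<beta>) = g (\<tau>, \<beta> - {#k#})" "g \<in> N (size (\<beta> - {#k#}))"
            "vanishes_above g (\<tau>, \<beta> - {#k#})"
          unfolding k(2)[symmetric] using L_E by blast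
        have kA: "k \<in> A" using k(1) sub by auto
        have gN: "g \<in> N d" using g(2) k(1) size by (simp add: size_Diff_singleton)
        \<comment> \<open>\<open>h\<close> is a product in \<open>D\<close> with the same leading term as \<open>f\<close>\<close>
        define h where "h = shift R k g"
        have h: "h \<in> N (Suc d)" "h \<in> D" using shift[OF gN kA] Dshift kA gN by (auto simp: h_def)
        have h_lead: "h (\<tau>, \<beta>) = f (\<tau>, \<beta>)" using k(1) g(1) by (simp add: h_def shift_def)
        have h_above: "vanishes_above h (\<tau>, \<beta>)"
          using shift_lead[OF g(3), of k] k(1) by (simp add: h_def)
        define f' where "f' = (\<lambda>x. f x \<oplus> \<ominus> \<one> \<otimes> h x)"
        have f'_eq: "f' x = f x \<ominus> h x" for x
          using car[OF h(1)] by (simp add: f'_def l_minus minus_eq)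
        have f': "f' \<in> N (Suc d)" unfolding f'_def
          by (intro add f smult h) simp
        have f'_above: "f' y = \<zero>" if "y \<ge> (\<tau>, \<beta>)" for y
        proof (cases "y = (\<tau>, \<beta>)")
          case True
          then show ?thesis using car[OF f] by (simp add: f'_eq h_lead minus_eq r_neg)
        next
          case False
          then have "y > (\<tau>, \<beta>)" using that by (metis order_le_less)
          then have "f y = \<zero>" "h y = \<zero>" using above h_above unfolding vanishes_above_def by blast+
          then show ?thesis by (simp add: f'_eq minus_eq)
        qed
        have "below f' \<subseteq> below f - {(\<tau>, \<beta>)}"
        proof
          fix x assume "x \<in> below f'"
          then obtain y where y: "x \<in> X" "x \<le> y" "f' y \<noteq> \<zero>" unfolding below_def by blast
          then have "y < (\<tau>, \<beta>)" using f'_above not_le by blast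
          then have "x < (\<tau>, \<beta>)" using y(2) by (rule le_less_trans[rotated])
          then show "x \<in> below f - {(\<tau>, \<beta>)}"
            using y(1) in_S less_imp_le unfolding below_def S_def by blast
        qed
        moreover have "(\<tau>, \<beta>) \<in> below f" using in_S S(3) unfolding below_def S_def by blast
        moreover have "finite (below f)" using finX by (simp add: below_def)
        ultimately have "card (below f') < card (below f)"
          by (intro psubset_card_mono) auto
        then have "f' \<in> D" using less.hyps f' by blast
        then have "(\<lambda>x. f' x \<oplus> h x) \<in> D" using Dadd h(2) by blast
        moreover have "(\<lambda>x. f' x \<oplus> h x) = f"
          using car[OF h(1)] car[OF f] by (auto simp: f'_eq minus_eq a_assoc l_neg)
        ultimately show ?thesis by simp
      qed
    qed
  qed
qed

section \<open>Powers of ideals\<close>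

lemma ideal_pow_0 [simp]: "ideal_pow R I 0 = carrier R"
  by (simp add: ideal_pow_def nat_pow_def ideals_set_def)

lemma ideal_pow_Suc [simp]: "ideal_pow R I (Suc n) = ideal_pow R I n \<cdot>\<^bsub>R\<^esub> I"
  by (simp add: ideal_pow_def nat_pow_def ideals_set_def)

context ring
begin

lemma ideal_pow_is_ideal:
  assumes "ideal I R"
  shows "ideal (ideal_pow R I n) R"
  by (induction n) (simp_all add: oneideal ideal_prod_is_ideal assms)

lemma ideal_pow_antimono:
  assumes "ideal I R" "m \<le> n"
  shows "ideal_pow R I n \<subseteq> ideal_pow R I m"
  using assms(2)
  by (rule lift_Suc_antimono_le[rotated])
    (use ideal_prod_inter ideal_pow_is_ideal assms(1) in force)

lemma ideal_pow_mult:
  assumes I: "ideal I R" and a: "a \<in> ideal_pow R I m" and b: "b \<in> ideal_pow R I n"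
  shows "a \<otimes> b \<in> ideal_pow R I (m + n)"
  using b
proof (induction n arbitrary: b)
  case 0
  then show ?case
    using a ideal.I_r_closed[OF ideal_pow_is_ideal[OF I]] by simp
next
  case (Suc n)
  have b: "b \<in> ideal_pow R I n \<cdot> I" using Suc.prems by simp
  have carr: "x \<in> carrier R" if "x \<in> ideal_pow R I k" for x k
    using ideal.Icarr[OF ideal_pow_is_ideal[OF I]] that by blast
  from b have "b \<in> carrier R \<and> a \<otimes> b \<in> ideal_pow R I (m + n) \<cdot> I"
  proof induction
    case (prod b r)
    have r: "r \<in> carrier R" using prod(2) ideal.Icarr[OF I] by blast
    show ?case
      using ideal_prod.prod[OF Suc.IH[OF prod(1)] prod(2), of R] r carr[OF a] carr[OF prod(1)]
      by (simp add: m_assoc)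
  next
    case (sum b b')
    then show ?case using carr[OF a] by (simp add: r_distr ideal_prod.sum)
  qed
  then show ?case by simp
qed

end

section \<open>Operations on forms\<close>

context ring
begin

lemma homogeneous_zero: "(\<lambda>x. \<zero>) \<in> homogeneous R T A d"
  by (simp add: homogeneous_def)

lemma homogeneous_add:
  "f \<in> homogeneous R T A d \<Longrightarrow> g \<in> homogeneous R T A d \<Longrightarrow> (\<lambda>x. f x \<oplus> g x) \<in> homogeneous R T A d"
  by (simp add: homogeneous_def)

lemma homogeneous_smult:
  "f \<in> homogeneous R T A d \<Longrightarrow> r \<in> carrier R \<Longrightarrow> (\<lambda>x. r \<otimes> f x) \<in> homogeneous R T A d"
  by (simp add: homogeneous_def)

lemma shift_closed: "(\<And>x. f x \<in> carrier R) \<Longrightarrow> shift R k f x \<in> carrier R"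
  by (simp add: shift_def split: prod.split)

lemma homogeneous_shift:
  assumes f: "f \<in> homogeneous R T A d" and k: "k \<in> A"
  shows "shift R k f \<in> homogeneous R T A (Suc d)"
  unfolding homogeneous_def
proof (intro CollectI conjI allI impI)
  fix x
  show "shift R k f x \<in> carrier R" 
    using f unfolding homogeneous_def by (intro shift_closed) blast
  assume x: "x \<notin> T \<times> multisets_of_size A (Suc d)"
  obtain \<tau> \<gamma> where Pair: "x = (\<tau>, \<gamma>)" by fastforce
  show "shift R k f x = \<zero>"
  proof (cases "k \<in># \<gamma>")
    case True
    then obtain \<beta> where \<gamma>: "\<gamma> = add_mset k \<beta>" by (metis mset_add)
    then have "(\<tau>, \<beta>) \<notin> T \<times> multisets_of_size A d"
      using x k by (auto simp: Pair multisets_of_size_def)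
    then show ?thesis using f by (simp add: Pair \<gamma> homogeneous_def)
  qed (simp add: Pair shift_def)
qed

end

section \<open>Colon submodules and the zeroth local cohomology\<close>

context module
begin

lemma gen_submodule_self: "S \<subseteq> gen_submodule R M S"
  by (auto simp: gen_submodule_def)

lemma gen_submodule_minimal:
  "submodule N R M \<Longrightarrow> S \<subseteq> N \<Longrightarrow> gen_submodule R M S \<subseteq> N"
  by (auto simp: gen_submodule_def)

lemma submodule_zero: "submodule N R M \<Longrightarrow> \<zero>\<^bsub>M\<^esub> \<in> N"
  using subgroup.one_closed[of N "add_monoid M"] by (simp add: submodule_def)

lemma gen_submodule_is_submodule:
  assumes "S \<subseteq> carrier M"
  shows "submodule (gen_submodule R M S) R M"
proof (rule submoduleI)
  show "gen_submodule R M S \<subseteq> carrier M"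
    using assms carrier_is_submodule by (rule gen_submodule_minimal[rotated])
qed (auto simp: gen_submodule_def submodule_zero dest: submoduleE)

text \<open>The set of scalars carrying \<open>m\<close> into a submodule is an ideal, so membership need only be tested on generators of an ideal.\<close>

lemma colon_ideal:
  assumes N: "submodule N R M" and m: "m \<in> carrier M"
  shows "ideal {r \<in> carrier R. r \<odot>\<^bsub>M\<^esub> m \<in> N} R" (is "ideal ?J R")
proof (rule idealI)
  show "ring R" ..
  show "subgroup ?J (add_monoid R)"
  proof (rule R.add.subgroupI)
    have "\<zero> \<in> ?J" using m submodule_zero[OF N] by simp
    then show "?J \<noteq> {}" by blast
    show "\<ominus> r \<in> ?J" if "r \<in> ?J" for r
      using that m submoduleE(3)[OF N] by (simp add: smult_l_minus)
    show "r \<oplus> r' \<in> ?J" if "r \<in> ?J" "r' \<in> ?J" for r r'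
      using that m submoduleE(5)[OF N] by (simp add: smult_l_distr)
  qed auto
  fix r x assume r: "r \<in> ?J" and x: "x \<in> carrier R"
  show "x \<otimes> r \<in> ?J" using r x m submoduleE(4)[OF N] by (simp add: smult_assoc1)
  then show "r \<otimes> x \<in> ?J" using r x by (simp add: m_comm)
qed

lemma colon_module_is_submodule:
  assumes N: "submodule N R M" and L: "L \<subseteq> carrier R"
  shows "submodule (colon_module M N L) R M"
proof (rule submoduleI)
  show "\<zero>\<^bsub>M\<^esub> \<in> colon_module M N L"
    using L by (auto simp: colon_module_def submodule_zero[OF N] subset_iff)
  show "\<ominus>\<^bsub>M\<^esub> x \<in> colon_module M N L" if "x \<in> colon_module M N L" for x
    using that L by (auto simp: colon_module_def smult_r_minus subset_iff submoduleE(3)[OF N])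
  show "x \<oplus>\<^bsub>M\<^esub> y \<in> colon_module M N L" if "x \<in> colon_module M N L" "y \<in> colon_module M N L" for x y
    using that L by (auto simp: colon_module_def smult_r_distr subset_iff submoduleE(5)[OF N])
  show "r \<odot>\<^bsub>M\<^esub> x \<in> colon_module M N L" if r: "r \<in> carrier R" and x: "x \<in> colon_module M N L" for r x
  proof -
    have "b \<odot>\<^bsub>M\<^esub> (r \<odot>\<^bsub>M\<^esub> x) \<in> N" if b: "b \<in> L" for b
    proof -
      have "b \<odot>\<^bsub>M\<^esub> (r \<odot>\<^bsub>M\<^esub> x) = r \<odot>\<^bsub>M\<^esub> (b \<odot>\<^bsub>M\<^esub> x)"
        using r x b L by (metis (no_types, lifting) colon_module_def mem_Collect_eq R.m_comm smult_assoc1 subsetD)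
      then show ?thesis using x b r submoduleE(4)[OF N] by (simp add: colon_module_def)
    qed
    then show ?thesis using r x by (simp add: colon_module_def)
  qed
qed (auto simp: colon_module_def)

lemma ideal_smult_is_submodule:
  "L \<subseteq> carrier R \<Longrightarrow> submodule (ideal_smult R M L) R M"
  unfolding ideal_smult_def by (rule gen_submodule_is_submodule) auto

lemma smult_in_ideal_smult:
  "b \<in> L \<Longrightarrow> x \<in> carrier M \<Longrightarrow> b \<odot>\<^bsub>M\<^esub> x \<in> ideal_smult R M L"
  unfolding ideal_smult_def by (rule subsetD[OF gen_submodule_self]) auto

lemma zero_submodule: "submodule {\<zero>\<^bsub>M\<^esub>} R M"
  by (rule submoduleI) auto

lemma ideal_pow_smult_power:
  assumes I: "ideal I R" and a: "a \<in> ideal_pow R I k"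
    and m: "m \<in> ideal_smult R M (ideal_pow R I n)"
  shows "a \<odot>\<^bsub>M\<^esub> m \<in> ideal_smult R M (ideal_pow R I (n + k))"
proof -
  have sub: "ideal_pow R I j \<subseteq> carrier R" for j
    using ideal.Icarr[OF R.ideal_pow_is_ideal[OF I]] by blast
  let ?C = "colon_module M (ideal_smult R M (ideal_pow R I (n + k))) {a}"
  have "ideal_smult R M (ideal_pow R I n) \<subseteq> ?C"
    unfolding ideal_smult_def[of R M "ideal_pow R I n"]
  proof (rule gen_submodule_minimal)
    show "submodule ?C R M"
      using a sub by (intro colon_module_is_submodule ideal_smult_is_submodule) auto
    show "{b \<odot>\<^bsub>M\<^esub> x |b x. b \<in> ideal_pow R I n \<and> x \<in> carrier M} \<subseteq> ?C"
    proof clarify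
      fix b x assume b: "b \<in> ideal_pow R I n" and x: "x \<in> carrier M"
      have carr: "a \<in> carrier R" "b \<in> carrier R" using a b sub by auto
      have "a \<otimes> b \<in> ideal_pow R I (n + k)"
        using R.ideal_pow_mult[OF I a b] by (simp add: add.commute)
      from smult_in_ideal_smult[OF this x]
      show "b \<odot>\<^bsub>M\<^esub> x \<in> ?C" using carr x by (simp add: colon_module_def smult_assoc1)
    qed
  qed
  then show ?thesis using m by (auto simp: colon_module_def)
qed

lemma H0_eq_colon: "H0 R M I = (\<Union>n\<in>{1..}. colon_module M {\<zero>\<^bsub>M\<^esub>} (ideal_pow R I n))"
  by (auto simp: H0_def colon_module_def)

text \<open>The annihilators in \<open>M\<close> of the powers \<open>I\<^sup>n\<close> form an ascending chain of submodules, and \<open>H\<^sup>0\<^sub>I(M)\<close> is their union.\<close>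

lemma H0_is_submodule:
  assumes I: "ideal I R"
  shows "submodule (H0 R M I) R M"
proof -
  let ?K = "\<lambda>n. colon_module M {\<zero>\<^bsub>M\<^esub>} (ideal_pow R I n)"
  have K: "submodule (?K n) R M" for n
    using ideal.Icarr[OF R.ideal_pow_is_ideal[OF I]]
    by (intro colon_module_is_submodule zero_submodule) blast
  have mono: "?K m \<subseteq> ?K n" if "m \<le> n" for m n
    using R.ideal_pow_antimono[OF I that] by (auto simp: colon_module_def)
  have in_H: "x \<in> H0 R M I" if "x \<in> ?K n" for x n
    using mono[of n "Suc n"] that unfolding H0_eq_colon by fastforce
  have H_E: "\<exists>n. x \<in> ?K n" if "x \<in> H0 R M I" for x
    using that unfolding H0_eq_colon by blast
  show ?thesis
  proof (rule submoduleI)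
    show "H0 R M I \<subseteq> carrier M" by (auto simp: H0_def)
    show "\<zero>\<^bsub>M\<^esub> \<in> H0 R M I" using in_H[OF submodule_zero[OF K]] .
    show "\<ominus>\<^bsub>M\<^esub> x \<in> H0 R M I" if "x \<in> H0 R M I" for x
      using H_E[OF that] in_H submoduleE(3)[OF K] by blast
    show "r \<odot>\<^bsub>M\<^esub> x \<in> H0 R M I" if "r \<in> carrier R" "x \<in> H0 R M I" for r x
      using H_E[OF that(2)] in_H submoduleE(4)[OF K that(1)] by blast
    show "x \<oplus>\<^bsub>M\<^esub> y \<in> H0 R M I" if xy: "x \<in> H0 R M I" "y \<in> H0 R M I" for x y
    proof -
      obtain m n where "x \<in> ?K m" "y \<in> ?K n" using xy H_E by blast
      then have "x \<in> ?K (max m n)" "y \<in> ?K (max m n)"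
        using mono[of m "max m n"] mono[of n "max m n"] by auto
      then show ?thesis using in_H submoduleE(5)[OF K] by blast
    qed
  qed
qed

text \<open>Passing to \<open>M/H\<^sup>0\<^sub>I(M)\<close> leaves no nonzero element killed by \<open>I\<close>. Finite generation of \<open>I\<close> matters
here: one power \<open>I\<^sup>n\<close> kills the products of \<open>m\<close> with all generators, whence \<open>I\<^sup>n\<^sup>+\<^sup>1\<close> kills \<open>m\<close>.\<close>

lemma H0_colon:
  assumes A: "finite A" "A \<subseteq> carrier R" and I: "I = Idl A"
    and m: "m \<in> carrier M" and "\<And>a. a \<in> A \<Longrightarrow> a \<odot>\<^bsub>M\<^esub> m \<in> H0 R M I"
  shows "m \<in> H0 R M I"
proof -
  have idI: "ideal I R" using R.genideal_ideal A(2) I by blast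
  let ?K = "\<lambda>n. colon_module M {\<zero>\<^bsub>M\<^esub>} (ideal_pow R I n)"
  have K: "submodule (?K n) R M" for n
    using ideal.Icarr[OF R.ideal_pow_is_ideal[OF idI]]
    by (intro colon_module_is_submodule zero_submodule) blast
  have mono: "?K m \<subseteq> ?K n" if "m \<le> n" for m n
    using R.ideal_pow_antimono[OF idI that] by (auto simp: colon_module_def)
  have "\<forall>a\<in>A. \<exists>n. a \<odot>\<^bsub>M\<^esub> m \<in> ?K n"
    using assms(5) unfolding H0_eq_colon by blast
  then obtain \<nu> where \<nu>: "\<And>a. a \<in> A \<Longrightarrow> a \<odot>\<^bsub>M\<^esub> m \<in> ?K (\<nu> a)" by metis
  define n where "n = Max (insert 0 (\<nu> ` A))"
  have "a \<odot>\<^bsub>M\<^esub> m \<in> ?K n" if "a \<in> A" for a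
    using \<nu>[OF that] mono[of "\<nu> a" n] that A(1) by (auto simp: n_def)
  then have "Idl A \<subseteq> {r \<in> carrier R. r \<odot>\<^bsub>M\<^esub> m \<in> ?K n}"
    using A(2) by (intro R.genideal_minimal colon_ideal K m) auto
  then have ann: "b \<odot>\<^bsub>M\<^esub> (r \<odot>\<^bsub>M\<^esub> m) = \<zero>\<^bsub>M\<^esub>" if "b \<in> ideal_pow R I n" "r \<in> I" for b r
    using that I by (auto simp: colon_module_def)
  have "c \<in> carrier R \<and> c \<odot>\<^bsub>M\<^esub> m = \<zero>\<^bsub>M\<^esub>" if "c \<in> ideal_pow R I n \<cdot> I" for c
    using that
  proof induction
    case (prod b r)
    then show ?case
      using ann m ideal.Icarr[OF idI] ideal.Icarr[OF R.ideal_pow_is_ideal[OF idI]]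
      by (simp add: smult_assoc1)
  next
    case (sum c c')
    then show ?case using m by (simp add: smult_l_distr)
  qed
  then have "m \<in> ?K (Suc n)" using m by (auto simp: colon_module_def)
  then show ?thesis unfolding H0_eq_colon by force
qed

end

section \<open>Values of forms at generators\<close>

text \<open>The generators are enumerated by natural numbers, since the monomial order needs linearly ordered variables and basis indices.\<close>

locale generated_module = module R M
  for R :: "('a, 'c) ring_scheme" (structure) and M :: "('a, 'b, 'd) module_scheme" (structure) +
  fixes I :: "'a set" and a :: "nat \<Rightarrow> 'a" and s :: nat and u :: "nat \<Rightarrow> 'b" and t :: nat
  assumes a_closed: "k < s \<Longrightarrow> a k \<in> carrier R"
    and I_generated: "I = Idl (a ` {..<s})"
    and u_closed: "j < t \<Longrightarrow> u j \<in> carrier M"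
    and M_generated: "carrier M = gen_submodule R M (u ` {..<t})"
begin

lemma I_ideal: "ideal I R"
  unfolding I_generated using a_closed by (intro R.genideal_ideal) auto

lemma ideal_pow_carrier: "ideal_pow R I d \<subseteq> carrier R"
  using ideal.Icarr[OF R.ideal_pow_is_ideal[OF I_ideal]] by blast

lemma a_in_I: "k < s \<Longrightarrow> a k \<in> I"
  unfolding I_generated using a_closed by (intro subsetD[OF R.genideal_self]) auto

lemma smult_I_closed:
  assumes "submodule N R M" "m \<in> carrier M" "\<And>k. k < s \<Longrightarrow> a k \<odot>\<^bsub>M\<^esub> m \<in> N" "r \<in> I"
  shows "r \<odot>\<^bsub>M\<^esub> m \<in> N"
proof -
  have "I \<subseteq> {r \<in> carrier R. r \<odot>\<^bsub>M\<^esub> m \<in> N}"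
    unfolding I_generated using assms(3) a_closed
    by (intro R.genideal_minimal colon_ideal assms(1,2)) auto
  then show ?thesis using assms(4) by blast
qed

abbreviation "IM d \<equiv> ideal_smult R M (ideal_pow R I d)"
abbreviation "H \<equiv> H0 R M I"

lemma IM_submodule: "submodule (IM d) R M"
  by (rule ideal_smult_is_submodule[OF ideal_pow_carrier])

lemma H_submodule: "submodule H R M"
  by (rule H0_is_submodule[OF I_ideal])

definition monomial :: "nat multiset \<Rightarrow> 'a"
  where "monomial \<beta> = (\<Otimes>k\<in>{..<s}. a k [^] count \<beta> k)"

lemma monomial_closed [simp]: "monomial \<beta> \<in> carrier R"
  unfolding monomial_def using a_closed by (intro R.finprod_closed) auto

lemma monomial_empty [simp]: "monomial {#} = \<one>"
  by (simp add: monomial_def)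

lemma monomial_add_mset:
  assumes k: "k < s"
  shows "monomial (add_mset k \<beta>) = a k \<otimes> monomial \<beta>"
proof -
  have "monomial (add_mset k \<beta>) = (\<Otimes>l\<in>{..<s}. (if k = l then a l else \<one>) \<otimes> a l [^] count \<beta> l)"
    unfolding monomial_def
    by (rule R.finprod_cong') (use a_closed in \<open>auto simp: R.m_comm\<close>)
  also have "\<dots> = (\<Otimes>l\<in>{..<s}. if k = l then a l else \<one>) \<otimes> monomial \<beta>"
    unfolding monomial_def using a_closed by (intro R.finprod_multf) auto
  also have "(\<Otimes>l\<in>{..<s}. if k = l then a l else \<one>) = a k"
    using k a_closed by (intro R.finprod_singleton) auto
  finally show ?thesis .
qed

lemma monomial_in_ideal_pow:
  "\<beta> \<in> multisets_of_size {..<s} d \<Longrightarrow> monomial \<beta> \<in> ideal_pow R I d"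
proof (induction \<beta> arbitrary: d)
  case empty
  then show ?case by (simp add: multisets_of_size_def)
next
  case (add k \<beta>)
  then obtain d' where d: "d = Suc d'" and k: "k < s" and \<beta>: "\<beta> \<in> multisets_of_size {..<s} d'"
    by (auto simp: multisets_of_size_def)
  have "monomial \<beta> \<otimes> a k \<in> ideal_pow R I d' \<cdot> I"
    by (rule ideal_prod.prod[OF add.IH[OF \<beta>] a_in_I[OF k]])
  then show ?case using k a_closed by (simp add: d monomial_add_mset R.m_comm)
qed

abbreviation "indices d \<equiv> {..<t} \<times> multisets_of_size {..<s} d"

lemma finite_indices: "finite (indices d)"
  by (intro finite_cartesian_product finite_multisets_of_size) auto

definition monomial_vector :: "nat \<times> nat multiset \<Rightarrow> 'b"
  where "monomial_vector = (\<lambda>(j, \<beta>). monomial \<beta> \<odot>\<^bsub>M\<^esub> u j)"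

lemma monomial_vector_closed: "x \<in> indices d \<Longrightarrow> monomial_vector x \<in> carrier M"
  using u_closed by (auto simp: monomial_vector_def)

definition evaluate :: "nat \<Rightarrow> (nat \<times> nat multiset \<Rightarrow> 'a) \<Rightarrow> 'b"
  where "evaluate d f = (\<Oplus>\<^bsub>M\<^esub>x\<in>indices d. f x \<odot>\<^bsub>M\<^esub> monomial_vector x)"

lemma evaluate_in_IM:
  assumes "\<And>x. f x \<in> carrier R"
  shows "evaluate d f \<in> IM d"
proof -
  have "f x \<odot>\<^bsub>M\<^esub> monomial_vector x \<in> IM d" if "x \<in> indices d" for x
  proof -
    have "monomial_vector x \<in> IM d"
      using that u_closed monomial_in_ideal_pow
      by (auto simp: monomial_vector_def intro!: smult_in_ideal_smult)
    then show ?thesis using assms submoduleE(4)[OF IM_submodule] by blast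
  qed
  moreover have "(\<Oplus>\<^bsub>M\<^esub>x\<in>F. f x \<odot>\<^bsub>M\<^esub> monomial_vector x) \<in> IM d"
    if "finite F" "\<And>x. x \<in> F \<Longrightarrow> f x \<odot>\<^bsub>M\<^esub> monomial_vector x \<in> IM d" for F
    using that
  proof induction
    case empty
    then show ?case using submodule_zero[OF IM_submodule] by simp
  next
    case (insert x F)
    have "(\<lambda>x. f x \<odot>\<^bsub>M\<^esub> monomial_vector x) \<in> F \<rightarrow> carrier M" "f x \<odot>\<^bsub>M\<^esub> monomial_vector x \<in> carrier M"
      using insert.prems submoduleE(1)[OF IM_submodule] by blast+
    from M.finsum_insert[OF insert.hyps this]
    show ?case using insert.IH insert.prems submoduleE(5)[OF IM_submodule] by simp
  qed
  ultimately show ?thesis unfolding evaluate_def using finite_indices by blast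
qed

lemma evaluate_closed: "(\<And>x. f x \<in> carrier R) \<Longrightarrow> evaluate d f \<in> carrier M"
  using evaluate_in_IM submoduleE(1)[OF IM_submodule] by blast

lemma evaluate_zero: "evaluate d (\<lambda>x. \<zero>) = \<zero>\<^bsub>M\<^esub>"
proof -
  have "evaluate d (\<lambda>x. \<zero>) = (\<Oplus>\<^bsub>M\<^esub>x\<in>indices d. \<zero>\<^bsub>M\<^esub>)"
    unfolding evaluate_def by (rule M.finsum_cong') (use monomial_vector_closed in auto)
  then show ?thesis by (simp add: M.finsum_zero)
qed

lemma evaluate_add:
  assumes "\<And>x. f x \<in> carrier R" "\<And>x. g x \<in> carrier R"
  shows "evaluate d (\<lambda>x. f x \<oplus> g x) = evaluate d f \<oplus>\<^bsub>M\<^esub> evaluate d g"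
proof -
  have "evaluate d (\<lambda>x. f x \<oplus> g x) = (\<Oplus>\<^bsub>M\<^esub>x\<in>indices d. f x \<odot>\<^bsub>M\<^esub> monomial_vector x \<oplus>\<^bsub>M\<^esub> g x \<odot>\<^bsub>M\<^esub> monomial_vector x)"
    unfolding evaluate_def
    by (rule M.finsum_cong') (use monomial_vector_closed assms in \<open>auto simp: smult_l_distr\<close>)
  also have "\<dots> = evaluate d f \<oplus>\<^bsub>M\<^esub> evaluate d g"
    unfolding evaluate_def by (rule M.finsum_addf) (use monomial_vector_closed assms in auto)
  finally show ?thesis .
qed

lemma evaluate_smult:
  assumes "\<And>x. f x \<in> carrier R" "r \<in> carrier R"
  shows "evaluate d (\<lambda>x. r \<otimes> f x) = r \<odot>\<^bsub>M\<^esub> evaluate d f"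
proof -
  have "evaluate d (\<lambda>x. r \<otimes> f x) = (\<Oplus>\<^bsub>M\<^esub>x\<in>indices d. r \<odot>\<^bsub>M\<^esub> (f x \<odot>\<^bsub>M\<^esub> monomial_vector x))"
    unfolding evaluate_def
    by (rule M.finsum_cong') (use monomial_vector_closed assms in \<open>auto simp: smult_assoc1\<close>)
  also have "\<dots> = r \<odot>\<^bsub>M\<^esub> evaluate d f"
    unfolding evaluate_def
    by (rule finsum_smult_ldistr[symmetric]) (use finite_indices monomial_vector_closed assms in auto)
  finally show ?thesis .
qed

text \<open>The variable \<open>k\<close> acts as multiplication by \<open>a k\<close>: the terms of a multiple of the variable \<open>k\<close> are indexed by the injective image of the indices one degree lower.\<close>

lemma evaluate_shift:
  assumes f: "\<And>x. f x \<in> carrier R" and k: "k < s"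
  shows "evaluate (Suc d) (shift R k f) = a k \<odot>\<^bsub>M\<^esub> evaluate d f"
proof -
  define up where "up = (\<lambda>(j :: nat, \<beta>). (j, add_mset k \<beta>))"
  have inj: "inj_on up X" for X by (auto simp: up_def inj_on_def)
  have up_indices: "up ` indices d \<subseteq> indices (Suc d)"
    using k by (auto simp: up_def multisets_of_size_def)
  have closed: "shift R k f x \<odot>\<^bsub>M\<^esub> monomial_vector x \<in> carrier M" if "x \<in> indices (Suc d)" for x
    using R.shift_closed[of f] f monomial_vector_closed[OF that] by simp
  have outside: "shift R k f x \<odot>\<^bsub>M\<^esub> monomial_vector x = \<zero>\<^bsub>M\<^esub>" if x: "x \<in> indices (Suc d) - up ` indices d" for x
  proof -
    obtain j \<gamma> where Pair: "x = (j, \<gamma>)" by fastforce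
    have "k \<notin># \<gamma>"
    proof
      assume "k \<in># \<gamma>"
      then obtain \<beta> where \<gamma>: "\<gamma> = add_mset k \<beta>" by (metis mset_add)
      then have "(j, \<beta>) \<in> indices d" "x = up (j, \<beta>)"
        using x by (auto simp: Pair up_def multisets_of_size_def)
      then show False using x by blast
    qed
    then have "shift R k f x = \<zero>" by (simp add: Pair shift_def)
    then show ?thesis using monomial_vector_closed[of x "Suc d"] x by simp
  qed
  have "evaluate (Suc d) (shift R k f) = (\<Oplus>\<^bsub>M\<^esub>x\<in>up ` indices d. shift R k f x \<odot>\<^bsub>M\<^esub> monomial_vector x)"
    unfolding evaluate_def
    by (rule M.add.finprod_mono_neutral_cong_right) (use finite_indices up_indices outside closed in auto)
  also have "\<dots> = (\<Oplus>\<^bsub>M\<^esub>x\<in>indices d. shift R k f (up x) \<odot>\<^bsub>M\<^esub> monomial_vector (up x))"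
    by (rule M.finsum_reindex) (use closed up_indices inj in auto)
  also have "\<dots> = (\<Oplus>\<^bsub>M\<^esub>x\<in>indices d. a k \<odot>\<^bsub>M\<^esub> (f x \<odot>\<^bsub>M\<^esub> monomial_vector x))"
  proof (rule M.finsum_cong')
    fix x assume x: "x \<in> indices d"
    obtain j \<beta> where Pair: "x = (j, \<beta>)" by fastforce
    have "u j \<in> carrier M" using x u_closed by (simp add: Pair)
    then show "shift R k f (up x) \<odot>\<^bsub>M\<^esub> monomial_vector (up x) = a k \<odot>\<^bsub>M\<^esub> (f x \<odot>\<^bsub>M\<^esub> monomial_vector x)"
      using f a_closed[OF k]
      by (simp add: Pair up_def monomial_vector_def monomial_add_mset[OF k] smult_assoc1[symmetric] R.m_assoc R.m_lcomm)
  qed (use f a_closed[OF k] monomial_vector_closed in auto)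
  also have "\<dots> = a k \<odot>\<^bsub>M\<^esub> evaluate d f"
    unfolding evaluate_def
    by (rule finsum_smult_ldistr[symmetric]) (use finite_indices monomial_vector_closed f a_closed[OF k] in auto)
  finally show ?thesis .
qed

text \<open>The values of forms of degree \<open>d\<close> form a submodule, and multiplication by \<open>I\<close> moves it into the one
for degree \<open>d + 1\<close>. In degree \<open>0\<close> it is all of \<open>M\<close>, so it contains \<open>I\<^sup>dM\<close> in degree \<open>d\<close>.\<close>

lemma evaluate_surj:
  assumes "x \<in> IM d"
  obtains c where "c \<in> homogeneous R {..<t} {..<s} d" "x = evaluate d c"
proof -
  define S where "S d = evaluate d ` homogeneous R {..<t} {..<s} d" for d
  have carr: "c x \<in> carrier R" if "c \<in> homogeneous R {..<t} {..<s} d" for c x d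
    using that unfolding homogeneous_def by blast
  have S: "submodule (S d) R M" for d
  proof (rule submoduleI)
    show "S d \<subseteq> carrier M" unfolding S_def using evaluate_closed carr by blast
    show "\<zero>\<^bsub>M\<^esub> \<in> S d"
      unfolding S_def using evaluate_zero[of d, symmetric] R.homogeneous_zero by (rule image_eqI)
    show smult: "r \<odot>\<^bsub>M\<^esub> x \<in> S d" if x: "x \<in> S d" and r: "r \<in> carrier R" for x r
    proof -
      obtain c where c: "c \<in> homogeneous R {..<t} {..<s} d" "x = evaluate d c"
        using x unfolding S_def by blast
      show ?thesis unfolding S_def
        by (rule image_eqI[OF _ R.homogeneous_smult[OF c(1) r]])
          (simp add: c(2) evaluate_smult carr[OF c(1)] r)
    qed
    show "\<ominus>\<^bsub>M\<^esub> x \<in> S d" if "x \<in> S d" for x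
    proof -
      have "x \<in> carrier M" using that unfolding S_def using evaluate_closed carr by blast
      then show ?thesis using smult[OF that, of "\<ominus> \<one>"] by (simp add: smult_l_minus)
    qed
    show "x \<oplus>\<^bsub>M\<^esub> y \<in> S d" if x: "x \<in> S d" and y: "y \<in> S d" for x y
    proof -
      obtain c c' where c: "c \<in> homogeneous R {..<t} {..<s} d" "x = evaluate d c"
        and c': "c' \<in> homogeneous R {..<t} {..<s} d" "y = evaluate d c'"
        using x y unfolding S_def by blast
      show ?thesis unfolding S_def
        by (rule image_eqI[OF _ R.homogeneous_add[OF c(1) c'(1)]])
          (simp add: c(2) c'(2) evaluate_add carr[OF c(1)] carr[OF c'(1)])
    qed
  qed
  have S_up: "r \<odot>\<^bsub>M\<^esub> x \<in> S (Suc d)" if r: "r \<in> I" and x: "x \<in> S d" for r x d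
  proof (rule smult_I_closed[OF S _ _ r])
    show "x \<in> carrier M" using x submoduleE(1)[OF S] by blast
    fix k assume k: "k < s"
    obtain c where c: "c \<in> homogeneous R {..<t} {..<s} d" "x = evaluate d c"
      using x unfolding S_def by blast
    show "a k \<odot>\<^bsub>M\<^esub> x \<in> S (Suc d)"
      unfolding S_def
      by (rule image_eqI[OF _ R.homogeneous_shift[OF c(1)]])
        (use k in \<open>simp_all add: c(2) evaluate_shift carr[OF c(1)]\<close>)
  qed
  have "u ` {..<t} \<subseteq> S 0"
  proof clarify
    fix j assume j: "j < t"
    \<comment> \<open>the form of degree \<open>0\<close> with single coefficient \<open>1\<close> at the basis index \<open>j\<close>\<close>
    let ?c = "\<lambda>x. if (j, {#}) = x then \<one> else \<zero>"
    have "evaluate 0 ?c = (\<Oplus>\<^bsub>M\<^esub>x\<in>indices 0. if (j, {#}) = x then monomial_vector x else \<zero>\<^bsub>M\<^esub>)"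
      unfolding evaluate_def by (rule M.finsum_cong') (use monomial_vector_closed[of _ 0] in auto)
    also have "\<dots> = monomial_vector (j, {#})"
      by (rule M.finsum_singleton) (use finite_indices[of 0] monomial_vector_closed[of _ 0] j in auto)
    also have "\<dots> = u j" using u_closed[OF j] by (simp add: monomial_vector_def)
    finally have "u j = evaluate 0 ?c" ..
    moreover have "?c \<in> homogeneous R {..<t} {..<s} 0"
      using j by (auto simp: homogeneous_def)
    ultimately show "u j \<in> S 0" unfolding S_def by (rule image_eqI)
  qed
  then have S_0: "carrier M \<subseteq> S 0"
    unfolding M_generated by (rule gen_submodule_minimal[OF S])
  have "b \<in> carrier R \<and> (\<forall>x\<in>carrier M. b \<odot>\<^bsub>M\<^esub> x \<in> S d)" if "b \<in> ideal_pow R I d" for b d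
    using that
  proof (induction d arbitrary: b)
    case 0
    then show ?case using S_0 by auto
  next
    case (Suc d)
    then have "b \<in> ideal_pow R I d \<cdot> I" by simp
    then show ?case
    proof induction
      case (prod b r)
      have r: "r \<in> carrier R" using prod(2) ideal.Icarr[OF I_ideal] by blast
      have "b \<otimes> r \<odot>\<^bsub>M\<^esub> x \<in> S (Suc d)" if x: "x \<in> carrier M" for x
      proof -
        have "b \<otimes> r \<odot>\<^bsub>M\<^esub> x = r \<odot>\<^bsub>M\<^esub> (b \<odot>\<^bsub>M\<^esub> x)"
          using Suc.IH[OF prod(1)] r x by (simp add: R.m_comm smult_assoc1[symmetric])
        then show ?thesis using S_up[OF prod(2)] Suc.IH[OF prod(1)] x by simp
      qed
      then show ?case using Suc.IH[OF prod(1)] r by blast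
    next
      case (sum b b')
      then show ?case using submoduleE(5)[OF S] by (simp add: smult_l_distr)
    qed
  qed
  then have "{b \<odot>\<^bsub>M\<^esub> x |b x. b \<in> ideal_pow R I d \<and> x \<in> carrier M} \<subseteq> S d"
    by blast
  then have "IM d \<subseteq> S d"
    unfolding ideal_smult_def by (rule gen_submodule_minimal[OF S])
  then show thesis using assms that unfolding S_def by blast
qed

section \<open>Congruence modulo the zeroth local cohomology\<close>

definition cong_H :: "'b \<Rightarrow> 'b \<Rightarrow> bool"
  where "cong_H x y \<longleftrightarrow> (\<exists>h\<in>H. x = y \<oplus>\<^bsub>M\<^esub> h)"

lemma H_closed: "h \<in> H \<Longrightarrow> h \<in> carrier M"
  using submoduleE(1)[OF H_submodule] by blast

lemma cong_H_refl: "x \<in> carrier M \<Longrightarrow> cong_H x x"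
  unfolding cong_H_def using submodule_zero[OF H_submodule] by (intro bexI[of _ "\<zero>\<^bsub>M\<^esub>"]) auto

lemma cong_H_add:
  assumes "cong_H x y" "cong_H x' y'" and y: "y \<in> carrier M" "y' \<in> carrier M"
  shows "cong_H (x \<oplus>\<^bsub>M\<^esub> x') (y \<oplus>\<^bsub>M\<^esub> y')"
proof -
  obtain h h' where h: "h \<in> H" "h' \<in> H" "x = y \<oplus>\<^bsub>M\<^esub> h" "x' = y' \<oplus>\<^bsub>M\<^esub> h'"
    using assms(1,2) unfolding cong_H_def by blast
  then have "x \<oplus>\<^bsub>M\<^esub> x' = (y \<oplus>\<^bsub>M\<^esub> y') \<oplus>\<^bsub>M\<^esub> (h \<oplus>\<^bsub>M\<^esub> h')"
    using y H_closed by (simp add: M.a_ac)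
  then show ?thesis unfolding cong_H_def using submoduleE(5)[OF H_submodule h(1,2)] by blast
qed

lemma cong_H_smult:
  assumes "cong_H x y" and y: "y \<in> carrier M" and r: "r \<in> carrier R"
  shows "cong_H (r \<odot>\<^bsub>M\<^esub> x) (r \<odot>\<^bsub>M\<^esub> y)"
proof -
  obtain h where h: "h \<in> H" "x = y \<oplus>\<^bsub>M\<^esub> h"
    using assms(1) unfolding cong_H_def by blast
  then have "r \<odot>\<^bsub>M\<^esub> x = r \<odot>\<^bsub>M\<^esub> y \<oplus>\<^bsub>M\<^esub> r \<odot>\<^bsub>M\<^esub> h"
    using y r H_closed by (simp add: smult_r_distr)
  then show ?thesis unfolding cong_H_def using submoduleE(4)[OF H_submodule r h(1)] by blast
qed

lemma cong_H_common:
  assumes "cong_H x z" "cong_H y z" and z: "z \<in> carrier M"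
  shows "x \<ominus>\<^bsub>M\<^esub> y \<in> H"
proof -
  obtain h h' where h: "h \<in> H" "h' \<in> H" "x = z \<oplus>\<^bsub>M\<^esub> h" "y = z \<oplus>\<^bsub>M\<^esub> h'"
    using assms(1,2) unfolding cong_H_def by blast
  have "x \<ominus>\<^bsub>M\<^esub> y = (z \<oplus>\<^bsub>M\<^esub> \<ominus>\<^bsub>M\<^esub> z) \<oplus>\<^bsub>M\<^esub> (h \<oplus>\<^bsub>M\<^esub> \<ominus>\<^bsub>M\<^esub> h')"
    using z h H_closed by (simp add: M.minus_eq M.minus_add M.a_ac del: M.r_neg)
  also have "\<dots> = h \<oplus>\<^bsub>M\<^esub> \<ominus>\<^bsub>M\<^esub> h'"
    using z h H_closed by (simp add: M.r_neg)
  finally show ?thesis using h submoduleE(3,5)[OF H_submodule] by simp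
qed

definition IM_H :: "nat \<Rightarrow> 'b set"
  where "IM_H d = {x. \<exists>y\<in>IM d. cong_H x y}"

lemma IM_H_closed: "x \<in> IM_H d \<Longrightarrow> x \<in> carrier M"
  unfolding IM_H_def cong_H_def using H_closed submoduleE(1)[OF IM_submodule] by blast

lemma IM_H_add: "x \<in> IM_H d \<Longrightarrow> y \<in> IM_H d \<Longrightarrow> x \<oplus>\<^bsub>M\<^esub> y \<in> IM_H d"
  unfolding IM_H_def using cong_H_add submoduleE(1,5)[OF IM_submodule] by blast

lemma IM_subset_IM_H: "IM d \<subseteq> IM_H d"
  unfolding IM_H_def using cong_H_refl submoduleE(1)[OF IM_submodule] by blast

lemma H_subset_IM_H: "H \<subseteq> IM_H d"
proof
  fix h assume h: "h \<in> H"
  then have "h = \<zero>\<^bsub>M\<^esub> \<oplus>\<^bsub>M\<^esub> h" using H_closed by simp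
  then show "h \<in> IM_H d"
    unfolding IM_H_def cong_H_def using h submodule_zero[OF IM_submodule] by blast
qed

lemma IM_H_eq: "IM_H d = IM d <+>\<^bsub>M\<^esub> H"
  by (auto simp: IM_H_def cong_H_def set_add_def set_mult_def)

section \<open>Stability of the colon submodules\<close>

text \<open>Forms with basis index \<open>(i, j)\<close> stand for \<open>s\<close>-tuples of forms with basis index \<open>j\<close>; \<open>slice i\<close> is the component \<open>i\<close> of the tuple.\<close>

definition slice :: "nat \<Rightarrow> ((nat \<times> nat) \<times> nat multiset \<Rightarrow> 'a) \<Rightarrow> nat \<times> nat multiset \<Rightarrow> 'a"
  where "slice i f = (\<lambda>(j, \<beta>). f ((i, j), \<beta>))"

lemma slice_zero: "slice i (\<lambda>x. \<zero>) = (\<lambda>x. \<zero>)"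
  and slice_add: "slice i (\<lambda>x. f x \<oplus> g x) = (\<lambda>x. slice i f x \<oplus> slice i g x)"
  and slice_smult: "slice i (\<lambda>x. r \<otimes> f x) = (\<lambda>x. r \<otimes> slice i f x)"
  and slice_shift: "slice i (shift R k f) = shift R k (slice i f)"
  by (auto simp: slice_def shift_def fun_eq_iff)

lemma slice_closed: "(\<And>x. f x \<in> carrier R) \<Longrightarrow> slice i f x \<in> carrier R"
  by (simp add: slice_def split: prod.split)

text \<open>The tuple \<open>(a\<^sub>i m)\<^sub>i\<close> is, modulo \<open>H\<close>, the tuple of values of the components of \<open>f\<close>. As the values lie
in \<open>I\<^sup>dM\<close>, this forces \<open>a\<^sub>i m \<in> I\<^sup>dM + H\<close> for each \<open>i\<close>, and the set of \<open>f\<close> representing some \<open>m\<close> is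
the pull-back of the image of \<open>(I\<^sup>dM + H : I)\<close>.\<close>

definition represents :: "nat \<Rightarrow> 'b \<Rightarrow> ((nat \<times> nat) \<times> nat multiset \<Rightarrow> 'a) \<Rightarrow> bool"
  where "represents d m f \<longleftrightarrow> (\<forall>i<s. cong_H (a i \<odot>\<^bsub>M\<^esub> m) (evaluate d (slice i f)))"

lemma represents_zero: "represents d \<zero>\<^bsub>M\<^esub> (\<lambda>x. \<zero>)"
  using a_closed by (simp add: represents_def slice_zero evaluate_zero cong_H_refl)

lemma represents_add:
  assumes "represents d m f" "represents d m' f'" "m \<in> carrier M" "m' \<in> carrier M"
    and "\<And>x. f x \<in> carrier R" "\<And>x. f' x \<in> carrier R"
  shows "represents d (m \<oplus>\<^bsub>M\<^esub> m') (\<lambda>x. f x \<oplus> f' x)"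
  using assms a_closed
  by (simp add: represents_def slice_add evaluate_add smult_r_distr cong_H_add evaluate_closed slice_closed)

lemma represents_smult:
  assumes "represents d m f" "m \<in> carrier M" "r \<in> carrier R" and f: "\<And>x. f x \<in> carrier R"
  shows "represents d (r \<odot>\<^bsub>M\<^esub> m) (\<lambda>x. r \<otimes> f x)"
  unfolding represents_def
proof (intro allI impI)
  fix i assume i: "i < s"
  have "a i \<odot>\<^bsub>M\<^esub> (r \<odot>\<^bsub>M\<^esub> m) = r \<odot>\<^bsub>M\<^esub> (a i \<odot>\<^bsub>M\<^esub> m)"
    using assms a_closed[OF i] by (simp add: smult_assoc1[symmetric] R.m_comm)
  moreover have "cong_H (a i \<odot>\<^bsub>M\<^esub> m) (evaluate d (slice i f))"
    using assms(1) i by (simp add: represents_def)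
  ultimately show "cong_H (a i \<odot>\<^bsub>M\<^esub> (r \<odot>\<^bsub>M\<^esub> m)) (evaluate d (slice i (\<lambda>x. r \<otimes> f x)))"
    using assms(3) cong_H_smult by (simp add: slice_smult evaluate_smult evaluate_closed slice_closed f)
qed

lemma represents_shift:
  assumes "represents d m f" "m \<in> carrier M" "k < s" and f: "\<And>x. f x \<in> carrier R"
  shows "represents (Suc d) (a k \<odot>\<^bsub>M\<^esub> m) (shift R k f)"
  unfolding represents_def
proof (intro allI impI)
  fix i assume i: "i < s"
  have "a i \<odot>\<^bsub>M\<^esub> (a k \<odot>\<^bsub>M\<^esub> m) = a k \<odot>\<^bsub>M\<^esub> (a i \<odot>\<^bsub>M\<^esub> m)"
    using assms a_closed i by (simp add: smult_assoc1[symmetric] R.m_comm)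
  moreover have "cong_H (a i \<odot>\<^bsub>M\<^esub> m) (evaluate d (slice i f))"
    using assms(1) i by (simp add: represents_def)
  ultimately show "cong_H (a i \<odot>\<^bsub>M\<^esub> (a k \<odot>\<^bsub>M\<^esub> m)) (evaluate (Suc d) (slice i (shift R k f)))"
    using assms(3) a_closed cong_H_smult
    by (simp add: slice_shift evaluate_shift evaluate_closed slice_closed f)
qed

lemma represents_exists:
  assumes "\<And>i. i < s \<Longrightarrow> a i \<odot>\<^bsub>M\<^esub> m \<in> IM_H d"
  obtains f where "f \<in> homogeneous R ({..<s} \<times> {..<t}) {..<s} d" "represents d m f"
proof -
  have "\<exists>c. c \<in> homogeneous R {..<t} {..<s} d \<and> cong_H (a i \<odot>\<^bsub>M\<^esub> m) (evaluate d c)" if i: "i < s" for i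
  proof -
    obtain y where y: "y \<in> IM d" "cong_H (a i \<odot>\<^bsub>M\<^esub> m) y"
      using assms[OF i] unfolding IM_H_def by blast
    obtain c where "c \<in> homogeneous R {..<t} {..<s} d" "y = evaluate d c"
      using evaluate_surj[OF y(1)] .
    then show ?thesis using y(2) by blast
  qed
  then obtain c where c: "\<And>i. i < s \<Longrightarrow> c i \<in> homogeneous R {..<t} {..<s} d"
      "\<And>i. i < s \<Longrightarrow> cong_H (a i \<odot>\<^bsub>M\<^esub> m) (evaluate d (c i))"
    by metis
  define f where "f = (\<lambda>((i, j), \<beta>). if i < s then c i (j, \<beta>) else \<zero>)"
  have "slice i f = c i" if "i < s" for i
    using that by (auto simp: slice_def f_def)
  then have "represents d m f" using c(2) by (simp add: represents_def)
  moreover have "f \<in> homogeneous R ({..<s} \<times> {..<t}) {..<s} d"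
    using c(1) by (auto simp: homogeneous_def f_def)
  ultimately show thesis using that by blast
qed

text \<open>For large \<open>d\<close>, a form of degree \<open>d + 1\<close> representing \<open>m\<close> is a sum of products of variables \<open>k\<close>
with forms representing elements \<open>m\<^sub>k\<close> in degree \<open>d\<close>. The sum \<open>m'\<close> of the \<open>a\<^sub>k m\<^sub>k\<close> is represented
by the same form as \<open>m\<close>, so \<open>I (m - m') \<subseteq> H\<close> and hence \<open>m - m' \<in> H\<close>; and \<open>m' \<in> I\<^sup>dM + H\<close> because
each \<open>m\<^sub>k\<close> is carried into \<open>I\<^sup>dM + H\<close> by \<open>a\<^sub>k\<close>.\<close>

lemma colon_stable:
  assumes noeth: "noetherian_ring R"
  shows "\<forall>\<^sub>F d in sequentially. \<forall>m\<in>carrier M. (\<forall>i<s. a i \<odot>\<^bsub>M\<^esub> m \<in> IM_H (Suc d)) \<longrightarrow> m \<in> IM_H d"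
proof -
  interpret N: noetherian_cring R
    by (rule noetherian_cring.intro[OF noeth R.is_cring])
  let ?F = "homogeneous R ({..<s} \<times> {..<t}) {..<s} :: nat \<Rightarrow> ((nat \<times> nat) \<times> nat multiset \<Rightarrow> 'a) set"
  define N where "N d = {f \<in> ?F d. \<exists>m\<in>carrier M. represents d m f}" for d
  have carr: "f x \<in> carrier R" if "f \<in> ?F d" for f x d
    using that unfolding homogeneous_def by blast
  have "\<forall>\<^sub>F d in sequentially. \<forall>D. (\<lambda>x. \<zero>) \<in> D
    \<longrightarrow> (\<forall>f\<in>D. \<forall>g\<in>D. (\<lambda>x. f x \<oplus> g x) \<in> D)
    \<longrightarrow> (\<forall>k\<in>{..<s}. \<forall>f\<in>N d. shift R k f \<in> D) \<longrightarrow> N (Suc d) \<subseteq> D"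
  proof (rule N.graded_submodule_generated)
    show "finite ({..<s} \<times> {..<t})" "finite {..<s}" by auto
    show "N d \<subseteq> ?F d" for d by (auto simp: N_def)
    show "(\<lambda>x. \<zero>) \<in> N d" for d
      unfolding N_def using represents_zero R.homogeneous_zero by blast
    show "(\<lambda>x. f x \<oplus> g x) \<in> N d" if fN: "f \<in> N d" "g \<in> N d" for d f g
    proof -
      obtain m m' where f: "f \<in> ?F d" "m \<in> carrier M" "represents d m f"
        and g: "g \<in> ?F d" "m' \<in> carrier M" "represents d m' g"
        using fN unfolding N_def by blast
      show ?thesis
        using represents_add[OF f(3) g(3) f(2) g(2) carr[OF f(1)] carr[OF g(1)]]
          R.homogeneous_add[OF f(1) g(1)] f(2) g(2) unfolding N_def by blast
    qed
    show "(\<lambda>x. r \<otimes> f x) \<in> N d" if fN: "f \<in> N d" "r \<in> carrier R" for d f r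
    proof -
      obtain m where f: "f \<in> ?F d" "m \<in> carrier M" "represents d m f"
        using fN unfolding N_def by blast
      show ?thesis
        using represents_smult[OF f(3,2) fN(2) carr[OF f(1)]]
          R.homogeneous_smult[OF f(1) fN(2)] f(2) fN(2) unfolding N_def by blast
    qed
    show "shift R k f \<in> N (Suc d)" if fN: "f \<in> N d" "k \<in> {..<s}" for d f k
    proof -
      obtain m where f: "f \<in> ?F d" "m \<in> carrier M" "represents d m f"
        using fN unfolding N_def by blast
      have k: "k < s" using fN(2) by simp
      show ?thesis
        using represents_shift[OF f(3,2) k carr[OF f(1)]]
          R.homogeneous_shift[OF f(1) fN(2)] f(2) a_closed[OF k] unfolding N_def by blast
    qed
  qed
  then show ?thesis
  proof (rule eventually_mono, intro ballI impI)
    fix d m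
    assume gen: "\<forall>D. (\<lambda>x. \<zero>) \<in> D
      \<longrightarrow> (\<forall>f\<in>D. \<forall>g\<in>D. (\<lambda>x. f x \<oplus> g x) \<in> D)
      \<longrightarrow> (\<forall>k\<in>{..<s}. \<forall>f\<in>N d. shift R k f \<in> D) \<longrightarrow> N (Suc d) \<subseteq> D"
      and m: "m \<in> carrier M" and am: "\<forall>i<s. a i \<odot>\<^bsub>M\<^esub> m \<in> IM_H (Suc d)"
    obtain f where f: "f \<in> ?F (Suc d)" "represents (Suc d) m f"
      using represents_exists[of m "Suc d"] am by blast
    then have fN: "f \<in> N (Suc d)" using m by (auto simp: N_def)
    \<comment> \<open>forms representing an element that already lies in \<open>I\<^sup>dM + H\<close>\<close>
    define D where "D = {f. (\<forall>x. f x \<in> carrier R) \<and> (\<exists>m\<in>IM_H d. represents (Suc d) m f)}"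
    have zero_IM_H: "\<zero>\<^bsub>M\<^esub> \<in> IM_H d" using submodule_zero[OF IM_submodule] IM_subset_IM_H by blast
    have D_zero: "(\<lambda>x. \<zero>) \<in> D" using zero_IM_H represents_zero by (auto simp: D_def)
    have D_add: "(\<lambda>x. f x \<oplus> g x) \<in> D" if fg: "f \<in> D" "g \<in> D" for f g
    proof -
      obtain m m' where "m \<in> IM_H d" "represents (Suc d) m f" "m' \<in> IM_H d" "represents (Suc d) m' g"
        using fg unfolding D_def by blast
      moreover have carr: "f x \<in> carrier R" "g x \<in> carrier R" for x using fg unfolding D_def by blast+
      ultimately have "represents (Suc d) (m \<oplus>\<^bsub>M\<^esub> m') (\<lambda>x. f x \<oplus> g x)" "m \<oplus>\<^bsub>M\<^esub> m' \<in> IM_H d"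
        by (auto intro: represents_add IM_H_add IM_H_closed)
      then show ?thesis unfolding D_def using carr by blast
    qed
    have D_shift: "shift R k f \<in> D" if k: "k \<in> {..<s}" and f: "f \<in> N d" for k f
    proof -
      obtain m where m: "m \<in> carrier M" "represents d m f" and "f \<in> ?F d"
        using f unfolding N_def by blast
      then have fc: "f x \<in> carrier R" for x using carr by blast
      have "a k \<odot>\<^bsub>M\<^esub> m \<in> IM_H d"
        unfolding IM_H_def
      proof (intro CollectI bexI)
        show "evaluate d (slice k f) \<in> IM d" by (intro evaluate_in_IM slice_closed fc)
        show "cong_H (a k \<odot>\<^bsub>M\<^esub> m) (evaluate d (slice k f))"
          using m(2) k by (simp add: represents_def)
      qed
      moreover have "represents (Suc d) (a k \<odot>\<^bsub>M\<^esub> m) (shift R k f)"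
        using k by (intro represents_shift[OF m(2,1)] fc) simp
      moreover have "shift R k f x \<in> carrier R" for x by (intro R.shift_closed fc)
      ultimately show ?thesis unfolding D_def by blast
    qed
    have "N (Suc d) \<subseteq> D"
      by (rule gen[rule_format]) (rule D_zero D_add D_shift; assumption?)+
    then obtain m' where m': "m' \<in> IM_H d" "represents (Suc d) m' f"
      using fN unfolding D_def by blast
    have m'c: "m' \<in> carrier M" using IM_H_closed m'(1) by blast
    have "m \<ominus>\<^bsub>M\<^esub> m' \<in> H"
    proof (rule H0_colon[OF _ _ I_generated])
      show "m \<ominus>\<^bsub>M\<^esub> m' \<in> carrier M" using m m'c by simp
      fix b assume "b \<in> a ` {..<s}"
      then obtain i where i: "i < s" "b = a i" by blast
      have "b \<odot>\<^bsub>M\<^esub> (m \<ominus>\<^bsub>M\<^esub> m') = a i \<odot>\<^bsub>M\<^esub> m \<ominus>\<^bsub>M\<^esub> a i \<odot>\<^bsub>M\<^esub> m'"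
        using m m'c a_closed i by (simp add: M.minus_eq smult_r_distr smult_r_minus)
      moreover have "\<dots> \<in> H"
        using f(2) m'(2) i(1) carr[OF f(1)]
        by (auto simp: represents_def intro!: cong_H_common evaluate_closed slice_closed)
      ultimately show "b \<odot>\<^bsub>M\<^esub> (m \<ominus>\<^bsub>M\<^esub> m') \<in> H" by simp
    qed (use a_closed in auto)
    then have "m \<ominus>\<^bsub>M\<^esub> m' \<in> IM_H d" using H_subset_IM_H by blast
    then have "m' \<oplus>\<^bsub>M\<^esub> (m \<ominus>\<^bsub>M\<^esub> m') \<in> IM_H d" by (rule IM_H_add[OF m'(1)])
    also have "m' \<oplus>\<^bsub>M\<^esub> (m \<ominus>\<^bsub>M\<^esub> m') = m"
      using m m'c by (simp add: M.minus_eq M.a_lcomm[of m' m] M.r_neg)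
    finally show "m \<in> IM_H d" .
  qed
qed

text \<open>Induction on \<open>k\<close>: for \<open>c \<in> I\<^sup>k\<close> the element \<open>c x\<close> is carried into \<open>I\<^sup>n\<^sup>+\<^sup>k\<^sup>+\<^sup>1M + H\<close> by every generator of \<open>I\<close>, so stability puts \<open>c x\<close> in \<open>I\<^sup>n\<^sup>+\<^sup>kM + H\<close>.\<close>

lemma colon_power_stable:
  assumes colon: "\<And>d m. n \<le> d \<Longrightarrow> m \<in> carrier M \<Longrightarrow> (\<forall>i<s. a i \<odot>\<^bsub>M\<^esub> m \<in> IM_H (Suc d)) \<Longrightarrow> m \<in> IM_H d"
    and x: "x \<in> carrier M" "\<And>c. c \<in> ideal_pow R I k \<Longrightarrow> c \<odot>\<^bsub>M\<^esub> x \<in> IM_H (n + k)"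
  shows "x \<in> IM_H n"
  using x(2)
proof (induction k)
  case 0
  then show ?case using 0[of \<one>] x(1) by simp
next
  case (Suc k)
  show ?case
  proof (rule Suc.IH)
    fix c assume c: "c \<in> ideal_pow R I k"
    then have cR: "c \<in> carrier R" using ideal_pow_carrier by blast
    show "c \<odot>\<^bsub>M\<^esub> x \<in> IM_H (n + k)"
    proof (rule colon)
      show "\<forall>i<s. a i \<odot>\<^bsub>M\<^esub> (c \<odot>\<^bsub>M\<^esub> x) \<in> IM_H (Suc (n + k))"
      proof (intro allI impI)
        fix i assume i: "i < s"
        have "c \<otimes> a i \<in> ideal_pow R I (Suc k)"
          using ideal_prod.prod[OF c a_in_I[OF i]] by simp
        from Suc.prems[OF this] show "a i \<odot>\<^bsub>M\<^esub> (c \<odot>\<^bsub>M\<^esub> x) \<in> IM_H (Suc (n + k))"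
          using cR a_closed[OF i] x(1) by (simp add: smult_assoc1[symmetric] R.m_comm)
      qed
    qed (use cR x(1) in simp_all)
  qed
qed

section \<open>The Ratliff-Rush submodules\<close>

lemma IM_H_subset_ratliff_rush: "IM_H n \<subseteq> ratliff_rush R M I n"
proof
  fix x assume "x \<in> IM_H n"
  then obtain y h where y: "y \<in> IM n" and h: "h \<in> H" and x: "x = y \<oplus>\<^bsub>M\<^esub> h"
    unfolding IM_H_def cong_H_def by blast
  have carr: "y \<in> carrier M" "h \<in> carrier M"
    using y h submoduleE(1)[OF IM_submodule] H_closed by blast+
  obtain k where k: "k \<ge> 1" "\<And>c. c \<in> ideal_pow R I k \<Longrightarrow> c \<odot>\<^bsub>M\<^esub> h = \<zero>\<^bsub>M\<^esub>"
    using h unfolding H0_def by blast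
  have "c \<odot>\<^bsub>M\<^esub> x \<in> IM (n + k)" if c: "c \<in> ideal_pow R I k" for c
  proof -
    have cR: "c \<in> carrier R" using c ideal_pow_carrier by blast
    then have "c \<odot>\<^bsub>M\<^esub> x = c \<odot>\<^bsub>M\<^esub> y"
      using carr k(2)[OF c] by (simp add: x smult_r_distr)
    then show ?thesis using ideal_pow_smult_power[OF I_ideal c y] by simp
  qed
  then have "x \<in> colon_module M (IM (n + k)) (ideal_pow R I k)"
    using carr by (simp add: x colon_module_def)
  then show "x \<in> ratliff_rush R M I n" unfolding ratliff_rush_def using k(1) by auto
qed

lemma eventually_ratliff_rush_eq:
  assumes "noetherian_ring R"
  shows "\<forall>\<^sub>F n in sequentially. ratliff_rush R M I n = IM n <+>\<^bsub>M\<^esub> H"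
proof -
  obtain n\<^sub>0 where n\<^sub>0: "\<And>d m. n\<^sub>0 \<le> d \<Longrightarrow> m \<in> carrier M \<Longrightarrow>
      (\<forall>i<s. a i \<odot>\<^bsub>M\<^esub> m \<in> IM_H (Suc d)) \<Longrightarrow> m \<in> IM_H d"
    using colon_stable[OF assms] unfolding eventually_sequentially by blast
  have "ratliff_rush R M I n \<subseteq> IM_H n" if n: "n\<^sub>0 \<le> n" for n
  proof
    fix x assume "x \<in> ratliff_rush R M I n"
    then obtain k where x: "x \<in> carrier M" "\<And>c. c \<in> ideal_pow R I k \<Longrightarrow> c \<odot>\<^bsub>M\<^esub> x \<in> IM (n + k)"
      unfolding ratliff_rush_def colon_module_def by blast
    show "x \<in> IM_H n"
      by (rule colon_power_stable[OF n\<^sub>0 x(1), of n k]) (use n x(2) IM_subset_IM_H in auto)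
  qed
  then show ?thesis
    unfolding eventually_sequentially IM_H_eq[symmetric] using IM_H_subset_ratliff_rush by blast
qed

end

theorem proposition7p5:
  fixes R :: "('a, 'c) ring_scheme" and M :: "('a, 'b, 'd) module_scheme" and I :: "'a set"
  assumes "cring R" and "noetherian_ring R"
    and "ideal I R"
    and "module R M" and "fin_gen_module R M"
  shows "\<forall>\<^sub>F n in sequentially.
    ratliff_rush R M I n = ideal_smult R M (ideal_pow R I n) <+>\<^bsub>M\<^esub> H0 R M I"
proof -
  obtain A where A: "A \<subseteq> carrier R \<and> finite A \<and> I = genideal R A"
    by (rule exE[OF noetherian_ring.finetely_gen[OF assms(2,3)]])
  obtain B where B: "B \<subseteq> carrier M \<and> finite B \<and> carrier M = gen_submodule R M B"
    by (rule exE[OF assms(5)[unfolded fin_gen_module_def]])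
  obtain s and a :: "nat \<Rightarrow> 'a" where a: "A = a ` {..<s}"
    using finite_imp_nat_seg_image_inj_on[of A] A by (auto simp: lessThan_def)
  obtain t and u :: "nat \<Rightarrow> 'b" where u: "B = u ` {..<t}"
    using finite_imp_nat_seg_image_inj_on[of B] B by (auto simp: lessThan_def)
  interpret module R M by (rule assms(4))
  interpret generated_module R M I a s u t
    by unfold_locales (use A B a u in auto)
  show ?thesis by (rule eventually_ratliff_rush_eq[OF assms(2)])
qed

end
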